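(* (1) $\mathrm{PSD}\subset\mathrm{PSD[O]}\subset\mathrm{PSD[T,O]}$; (2) $\mathrm{PSD}\subset\mathrm{PSD[T]}\subset\mathrm{PSD[T,O]}$; (3) $\mathrm{PSD[O]}\setminus\mathrm{PSD[T]}\neq\emptyset$; (4) $\mathrm{PSD[T]}\setminus\mathrm{PSD[O]}\neq\emptyset$. Here $\subset$ denotes proper inclusion.
   Context: An indexed family is a sequence $\mathcal F=(F_n)_{n\in\mathbb N}$ of subsets of $\mathbb N$ that is uniformly computably enumerable; $F\in\mathcal F$ means $F=F_n$ for some $n$, and $\mathrm{mi}_{\mathcal F}(F)$ is the least $n$ with $F_n=F$. An enumeration of a nonempty set $A$ is an infinite sequence of elements of $A$ in which every element of $A$ occurs; $f\restriction n$ is its initial segment of length $n$, and $\mathrm{content}(\sigma)$ is the set of entries of a finite string $\sigma$. A learner is a partial computable function from finite strings of naturals to naturals; hypothesis $h$ is interpreted as $F_h$. $\mathcal F$ is PSD-learnable if there are a learner $M$ and a polynomial $p$ such that for every $F\in\mathcal F$ and every enumeration $f$ of $F$, there is $n$ with $|\mathrm{content}(f\restriction n)|<p(\mathrm{mi}_{\mathcal F}(F))$ such that $M(f\restriction j)=M(f\restriction n)$ for all $j\ge n$ and $F_{M(f\restriction n)}=F$; if an oracle is used, the number of oracle queries is also bounded by $p(\mathrm{mi}_{\mathcal F}(F))$. A teacher is a computable map $T$ on finite strings with $T(\sigma)$ a prefix of $T(\tau)$ whenever $\sigma$ is a prefix of $\tau$, and $\mathrm{content}(T(\sigma))\subseteq\mathrm{content}(\sigma)$.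 PSD[O]-learnable: some learner with a membership oracle for the target set PSD-learns $\mathcal F$. PSD[T]-learnable: there is a learner-teacher pair $(M,T)$ such that $M$, fed $T(f\restriction n)$ in place of $f\restriction n$ (i.e. on the data stream $T\circ f$), meets the PSD criterion for every enumeration $f$ of every member of $\mathcal F$. PSD[T,O]-learnable: as for PSD[T], but $M$ additionally has a membership oracle for the target and $T$ has access to the oracle answers $M$ receives. PSD, PSD[O], PSD[T], PSD[T,O] denote the corresponding classes of indexed families. *)

theory Defs
  imports "HOL-Library.Nat_Bijection" "HOL-Library.Sublist" "HOL-Computational_Algebra.Polynomial"
begin

datatype recf =
    Zero
  | Succ
  | Proj nat
  | Comp recf "recf list"
  | PrimRec recf recf
  | Mu recf
  | Oracle

inductive ev :: "nat set \<Rightarrow> recf \<Rightarrow> nat list \<Rightarrow> nat \<Rightarrow> nat list \<Rightarrow> bool"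
  and evs :: "nat set \<Rightarrow> recf list \<Rightarrow> nat list \<Rightarrow> nat list \<Rightarrow> nat list \<Rightarrow> bool"
  and evmu :: "nat set \<Rightarrow> recf \<Rightarrow> nat list \<Rightarrow> nat \<Rightarrow> nat \<Rightarrow> nat list \<Rightarrow> bool"
  for A :: "nat set"
where
  ev_zero: "ev A Zero xs 0 []"
| ev_succ: "ev A Succ (x # xs) (Suc x) []"
| ev_proj: "i < length xs \<Longrightarrow> ev A (Proj i) xs (xs ! i) []"
| ev_oracle: "ev A Oracle (x # xs) (if x \<in> A then 1 else 0) [x]"
| ev_comp: "evs A gs xs ys qs \<Longrightarrow> ev A f ys y q \<Longrightarrow> ev A (Comp f gs) xs y (qs @ q)"
| ev_prim0: "ev A f xs y q \<Longrightarrow> ev A (PrimRec f g) (0 # xs) y q"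
| ev_primS: "ev A (PrimRec f g) (n # xs) r q \<Longrightarrow> ev A g (n # r # xs) y q'
              \<Longrightarrow> ev A (PrimRec f g) (Suc n # xs) y (q @ q')"
| ev_mu: "evmu A f xs 0 y q \<Longrightarrow> ev A (Mu f) xs y q"
| evs_nil: "evs A [] xs [] []"
| evs_cons: "ev A g xs y q \<Longrightarrow> evs A gs xs ys qs \<Longrightarrow> evs A (g # gs) xs (y # ys) (q @ qs)"
| evmu_found: "ev A f (n # xs) 0 q \<Longrightarrow> evmu A f xs n n q"
| evmu_next: "ev A f (n # xs) (Suc k) q \<Longrightarrow> evmu A f xs (Suc n) y q'
              \<Longrightarrow> evmu A f xs n y (q @ q')"

fun oracle_free :: "recf \<Rightarrow> bool" where
  "oracle_free Oracle = False"
| "oracle_free (Comp f gs) = (oracle_free f \<and> (\<forall>g\<in>set gs. oracle_free g))"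
| "oracle_free (PrimRec f g) = (oracle_free f \<and> oracle_free g)"
| "oracle_free (Mu f) = oracle_free f"
| "oracle_free _ = True"

definition conv :: "nat set \<Rightarrow> recf \<Rightarrow> nat list \<Rightarrow> bool" where
  "conv A M \<sigma> = (\<exists>y q. ev A M [list_encode \<sigma>] y q)"

definition res :: "nat set \<Rightarrow> recf \<Rightarrow> nat list \<Rightarrow> nat" where
  "res A M \<sigma> = (THE y. \<exists>q. ev A M [list_encode \<sigma>] y q)"

definition queries :: "nat set \<Rightarrow> recf \<Rightarrow> nat list \<Rightarrow> nat list" where
  "queries A M \<sigma> = (THE q. \<exists>y. ev A M [list_encode \<sigma>] y q)"

definition indexed_family :: "(nat \<Rightarrow> nat set) \<Rightarrow> bool" where
  "indexed_family F = (\<exists>e. oracle_free e \<and>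
      (\<forall>n x. x \<in> F n \<longleftrightarrow> (\<exists>y q. ev {} e [n, x] y q)))"

definition mi :: "(nat \<Rightarrow> nat set) \<Rightarrow> nat set \<Rightarrow> nat" where
  "mi F S = (LEAST n. F n = S)"

definition enumeration :: "(nat \<Rightarrow> nat) \<Rightarrow> nat set \<Rightarrow> bool" where
  "enumeration f S = (S \<noteq> {} \<and> range f = S)"

definition restr :: "(nat \<Rightarrow> nat) \<Rightarrow> nat \<Rightarrow> nat list" where
  "restr f n = map f [0..<n]"

text \<open>A teacher with access to the oracle answers: a computable map taking the data
  seen so far and the list of (query, answer) pairs received by the learner so far.
  A plain teacher is one that ignores the second argument.\<close>

definition enc_hist :: "(nat \<times> bool) list \<Rightarrow> nat" where
  "enc_hist H = list_encode (map (\<lambda>(x, b). prod_encode (x, if b then 1 else 0)) H)"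

definition teacher :: "(nat list \<Rightarrow> nat list) \<Rightarrow> bool" where
  "teacher T = ((\<exists>t. oracle_free t \<and> (\<forall>\<sigma>. \<exists>q. ev {} t [list_encode \<sigma>] (list_encode (T \<sigma>)) q))
     \<and> (\<forall>\<sigma> \<tau>. prefix \<sigma> \<tau> \<longrightarrow> prefix (T \<sigma>) (T \<tau>))
     \<and> (\<forall>\<sigma>. set (T \<sigma>) \<subseteq> set \<sigma>))"

definition teacher_O :: "(nat list \<Rightarrow> (nat \<times> bool) list \<Rightarrow> nat list) \<Rightarrow> bool" where
  "teacher_O T = ((\<exists>t. oracle_free t \<and>
        (\<forall>\<sigma> H. \<exists>q. ev {} t [list_encode \<sigma>, enc_hist H] (list_encode (T \<sigma> H)) q))
     \<and> (\<forall>\<sigma> \<tau> H H'. prefix \<sigma> \<tau> \<longrightarrow> prefix H H' \<longrightarrow> prefix (T \<sigma> H) (T \<tau> H'))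
     \<and> (\<forall>\<sigma> H. set (T \<sigma> H) \<subseteq> set \<sigma>))"

primrec hist :: "nat set \<Rightarrow> recf \<Rightarrow> (nat list \<Rightarrow> (nat \<times> bool) list \<Rightarrow> nat list)
                  \<Rightarrow> (nat \<Rightarrow> nat) \<Rightarrow> nat \<Rightarrow> (nat \<times> bool) list" where
  "hist A M T f 0 = []"
| "hist A M T f (Suc n) =
     (let d = T (restr f n) (hist A M T f n) in
      hist A M T f n @
        (if conv A M d then map (\<lambda>x. (x, x \<in> A)) (queries A M d) else []))"

definition data :: "nat set \<Rightarrow> recf \<Rightarrow> (nat list \<Rightarrow> (nat \<times> bool) list \<Rightarrow> nat list)
                  \<Rightarrow> (nat \<Rightarrow> nat) \<Rightarrow> nat \<Rightarrow> nat list" where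
  "data A M T f n = T (restr f n) (hist A M T f n)"

definition psd_crit :: "(nat \<Rightarrow> nat set) \<Rightarrow> recf \<Rightarrow> (nat list \<Rightarrow> (nat \<times> bool) list \<Rightarrow> nat list)
                        \<Rightarrow> nat poly \<Rightarrow> bool" where
  "psd_crit F M T p = (\<forall>i f. enumeration f (F i) \<longrightarrow>
     (\<exists>n. card (set (data (F i) M T f n)) < poly p (mi F (F i))
        \<and> length (hist (F i) M T f (Suc n)) < poly p (mi F (F i))
        \<and> conv (F i) M (data (F i) M T f n)
        \<and> (\<forall>j\<ge>n. conv (F i) M (data (F i) M T f j)
                 \<and> res (F i) M (data (F i) M T f j) = res (F i) M (data (F i) M T f n))
        \<and> F (res (F i) M (data (F i) M T f n)) = F i))"

definition PSD :: "(nat \<Rightarrow> nat set) set" where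
  "PSD = {F. indexed_family F \<and>
     (\<exists>M p. oracle_free M \<and> psd_crit F M (\<lambda>\<sigma> H. \<sigma>) p)}"

definition PSD_O :: "(nat \<Rightarrow> nat set) set" where
  "PSD_O = {F. indexed_family F \<and> (\<exists>M p. psd_crit F M (\<lambda>\<sigma> H. \<sigma>) p)}"

definition PSD_T :: "(nat \<Rightarrow> nat set) set" where
  "PSD_T = {F. indexed_family F \<and>
     (\<exists>M T p. oracle_free M \<and> teacher T \<and> psd_crit F M (\<lambda>\<sigma> H. T \<sigma>) p)}"

definition PSD_TO :: "(nat \<Rightarrow> nat set) set" where
  "PSD_TO = {F. indexed_family F \<and>
     (\<exists>M T p. teacher_O T \<and> psd_crit F M T p)}"

end

theory Submission
  imports Defs "HOL-Library.Omega_Words_Fun"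
begin

text \<open>A teacher can choose the data so that only boundedly many distinct elements are ever shown, so
  \<open>PSD_T\<close> amounts to learning in the limit, whereas an oracle allows few queries but does not slow
  down the growth of the content. The natural numbers together with their finite initial segments
  are not learnable in the limit from positive data (Gold): a locking sequence for the set of all
  natural numbers also locks the learner on every sufficiently large initial segment. An oracle,
  however, finds the missing elements. Conversely, a learner without a teacher must decide after
  polynomially many distinct data; simulating it on that many data with a universal machine, one
  diagonalises by letting one of two competing hypotheses differ from the target only at the
  encoded halting times of the simulated run. A teacher learns the diagonal family by passing on
  one element and the first encoded halting time that occurs, if any.\<close>

hide_const (open) Omega_Words_Fun.prefix

section \<open>Evaluation\<close>

inductive_cases ev_elims:
  "ev A Zero xs y q" "ev A Succ xs y q" "ev A (Proj i) xs y q" "ev A Oracle xs y q"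
  "ev A (Comp f gs) xs y q" "ev A (PrimRec f g) (0 # xs) y q"
  "ev A (PrimRec f g) (Suc n # xs) y q" "ev A (Mu f) xs y q"
inductive_cases evs_elims: "evs A [] xs ys q" "evs A (g # gs) xs ys q"

lemma ev_deterministic:
  "ev A f xs y q \<Longrightarrow> ev A f xs y' q' \<Longrightarrow> y' = y \<and> q' = q"
  "evs A gs xs ys q \<Longrightarrow> evs A gs xs ys' q' \<Longrightarrow> ys' = ys \<and> q' = q"
  "evmu A f xs n y q \<Longrightarrow> evmu A f xs n y' q' \<Longrightarrow> y' = y \<and> q' = q"
proof (induction arbitrary: y' q' and ys' q' and y' q' rule: ev_evs_evmu.inducts)
  case (evmu_found f n xs q)
  from evmu_found.prems show ?case
    by (cases rule: evmu.cases) (use evmu_found.IH in blast)+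
next
  case (evmu_next f n xs k q y q1)
  from evmu_next.prems show ?case
    by (cases rule: evmu.cases) (use evmu_next.IH in blast)+
qed (blast elim!: ev_elims evs_elims)+

lemmas ev_query_free_intros =
  ev_zero ev_succ ev_proj ev_comp[where qs = "[]" and q = "[]", simplified] ev_prim0
  ev_primS[where q = "[]" and q' = "[]", simplified] ev_mu
  evs_nil evs_cons[where q = "[]" and qs = "[]", simplified]
  evmu_found evmu_next[where q = "[]" and q' = "[]", simplified]

lemma oracle_free_ev:
  "ev A f xs y q \<Longrightarrow> oracle_free f \<Longrightarrow> ev B f xs y q \<and> q = []"
  "evs A gs xs ys q \<Longrightarrow> \<forall>g\<in>set gs. oracle_free g \<Longrightarrow> evs B gs xs ys q \<and> q = []"
  "evmu A f xs n y q \<Longrightarrow> oracle_free f \<Longrightarrow> evmu B f xs n y q \<and> q = []"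
  by (induction rule: ev_evs_evmu.inducts) (auto intro: ev_query_free_intros)

lemma ev_Mu_Least:
  assumes ev: "\<And>n. ev A e (n # xs) (f n) []" and ex: "\<exists>n. f n = 0"
  shows "ev A (Mu e) xs (LEAST n. f n = 0) []"
proof -
  define m where "m = (LEAST n. f n = 0)"
  have "f m = 0" unfolding m_def using ex by (rule LeastI_ex)
  have "evmu A e xs n m []" if "n \<le> m" for n
    using that
  proof (induction rule: inc_induct)
    case base
    show ?case using evmu_found ev[of m] \<open>f m = 0\<close> by metis
  next
    case (step n)
    then have "f n \<noteq> 0"
      using not_less_Least[of n "\<lambda>n. f n = 0"] by (simp add: m_def)
    then obtain k where "ev A e (n # xs) (Suc k) []"
      using ev[of n] not0_implies_Suc by metis
    from evmu_next[OF this step.IH] show ?case by simp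
  qed
  then show ?thesis by (simp add: m_def ev_mu)
qed

lemma evmu_imp_zero: "evmu A f xs n y q \<Longrightarrow> \<exists>q'. ev A f (y # xs) 0 q'"
  by (induction rule: ev_evs_evmu.inducts(3)
      [where ?P1.0 = "\<lambda>_ _ _ _. True" and ?P2.0 = "\<lambda>_ _ _ _. True"]) auto

section \<open>The learning criterion\<close>

definition outputs :: "nat set \<Rightarrow> recf \<Rightarrow> nat list \<Rightarrow> nat \<Rightarrow> bool" where
  "outputs A M \<sigma> r \<longleftrightarrow> (\<exists>q. ev A M [list_encode \<sigma>] r q)"

lemma queries_eq: "ev A M [list_encode \<sigma>] r q \<Longrightarrow> queries A M \<sigma> = q"
  unfolding queries_def by (rule the_equality) (blast dest: ev_deterministic(1))+

lemma res_eq: "outputs A M \<sigma> r \<Longrightarrow> res A M \<sigma> = r"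
  unfolding res_def outputs_def by (rule the_equality) (blast dest: ev_deterministic(1))+

lemma outputs_iff_conv_res: "outputs A M \<sigma> r \<longleftrightarrow> conv A M \<sigma> \<and> res A M \<sigma> = r"
  using res_eq unfolding conv_def by (metis outputs_def)

lemma psd_crit_iff:
  "psd_crit F M T p \<longleftrightarrow> (\<forall>i f. enumeration f (F i) \<longrightarrow>
     (\<exists>n r. card (set (data (F i) M T f n)) < poly p (mi F (F i))
        \<and> length (hist (F i) M T f (Suc n)) < poly p (mi F (F i))
        \<and> (\<forall>j\<ge>n. outputs (F i) M (data (F i) M T f j) r)
        \<and> F r = F i))"
proof -
  have "conv A M (d n) \<and> (\<forall>j\<ge>n. conv A M (d j) \<and> res A M (d j) = res A M (d n))
        \<and> F (res A M (d n)) = S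
      \<longleftrightarrow> (\<exists>r. (\<forall>j\<ge>n. outputs A M (d j) r) \<and> F r = S)" for A d S and n :: nat
    unfolding outputs_iff_conv_res by (metis order_refl)
  then show ?thesis unfolding psd_crit_def by simp
qed

lemma data_plain_teacher: "data A M (\<lambda>\<sigma> H. T \<sigma>) f n = T (restr f n)"
  by (simp add: data_def)

lemma outputs_oracle_free: "oracle_free M \<Longrightarrow> outputs A M \<sigma> r \<longleftrightarrow> outputs B M \<sigma> r"
  unfolding outputs_def using oracle_free_ev(1) by blast

lemma length_hist_le:
  assumes "\<And>\<sigma>. conv A M \<sigma> \<Longrightarrow> length (queries A M \<sigma>) \<le> b"
  shows "length (hist A M T f n) \<le> n * b"
  by (induction n) (auto simp: Let_def add.commute[of b] intro: add_mono assms)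

lemma hist_oracle_free:
  assumes "oracle_free M"
  shows "hist A M T f n = []"
proof -
  have "queries A M \<sigma> = []" if "conv A M \<sigma>" for \<sigma>
    using that assms queries_eq oracle_free_ev(1) unfolding conv_def by metis
  then show ?thesis using length_hist_le[of A M 0] by simp
qed

lemma mi_le: "mi F (F i) \<le> i"
  unfolding mi_def by (rule Least_le) simp

lemma set_restr_mono: "m \<le> n \<Longrightarrow> set (restr f m) \<subseteq> set (restr f n)"
  by (auto simp: restr_def)

lemma restr_conc: "restr (\<sigma> \<frown> f) (length \<sigma> + n) = \<sigma> @ restr f n"
  by (rule nth_equalityI) (auto simp: restr_def nth_append)

lemma psd_crit_decided:
  assumes crit: "psd_crit F M (\<lambda>\<sigma> H. \<sigma>) p" and f: "enumeration f (F i)"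
    and many: "poly p (mi F (F i)) \<le> card (set (restr f b))"
  obtains r where "outputs (F i) M (restr f b) r" "F r = F i"
proof -
  obtain n r where few: "card (set (restr f n)) < poly p (mi F (F i))"
    and r: "\<And>j. j \<ge> n \<Longrightarrow> outputs (F i) M (restr f j) r" "F r = F i"
    using crit f unfolding psd_crit_iff data_plain_teacher by blast
  have "n \<le> b"
  proof (rule ccontr)
    assume "\<not> n \<le> b"
    then have "card (set (restr f b)) \<le> card (set (restr f n))"
      by (intro card_mono set_restr_mono) auto
    with few many show False by simp
  qed
  with r that show thesis by blast
qed

section \<open>Total computable functions\<close>

definition computable :: "nat \<Rightarrow> (nat list \<Rightarrow> nat) \<Rightarrow> bool" where
  "computable k f \<longleftrightarrow>
     (\<exists>e. oracle_free e \<and> (\<forall>A xs. length xs = k \<longrightarrow> ev A e xs (f xs) []))"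

lemma computable_cong:
  "(\<And>xs. length xs = k \<Longrightarrow> f xs = g xs) \<Longrightarrow> computable k f \<longleftrightarrow> computable k g"
  unfolding computable_def by metis

lemma computable_nth: "i < k \<Longrightarrow> computable k (\<lambda>xs. xs ! i)"
  unfolding computable_def by (rule exI[of _ "Proj i"]) (auto intro: ev_proj)

lemma computable_list_imp_evs:
  assumes "\<forall>g\<in>set gs. computable k g"
  shows "\<exists>es. (\<forall>e\<in>set es. oracle_free e) \<and>
    (\<forall>A xs. length xs = k \<longrightarrow> evs A es xs (map (\<lambda>g. g xs) gs) [])"
  using assms
proof (induction gs)
  case Nil
  show ?case by (rule exI[of _ "[]"]) (auto intro: evs_nil)
next
  case (Cons g gs)
  then obtain es e where "\<forall>e\<in>set es. oracle_free e"
    "\<forall>A xs. length xs = k \<longrightarrow> evs A es xs (map (\<lambda>g. g xs) gs) []"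
    "oracle_free e" "\<forall>A xs. length xs = k \<longrightarrow> ev A e xs (g xs) []"
    by (auto simp: computable_def)
  then show ?case by (intro exI[of _ "e # es"]) (auto intro: ev_query_free_intros)
qed

lemma computable_comp:
  assumes "computable (length gs) f" and "\<forall>g\<in>set gs. computable k g"
  shows "computable k (\<lambda>xs. f (map (\<lambda>g. g xs) gs))"
proof -
  obtain es where "\<forall>e\<in>set es. oracle_free e"
    "\<forall>A xs. length xs = k \<longrightarrow> evs A es xs (map (\<lambda>g. g xs) gs) []"
    using computable_list_imp_evs[OF assms(2)] by blast
  moreover obtain e where "oracle_free e"
    "\<forall>A xs. length xs = length gs \<longrightarrow> ev A e xs (f xs) []"
    using assms(1) by (auto simp: computable_def)
  ultimately show ?thesis
    unfolding computable_def by (intro exI[of _ "Comp e es"]) (auto intro!: ev_query_free_intros)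
qed

lemma computable_tl:
  assumes "computable k f"
  shows "computable (Suc k) (\<lambda>xs. f (tl xs))"
proof -
  let ?projs = "map (\<lambda>i xs. xs ! Suc i) [0..<k] :: (nat list \<Rightarrow> nat) list"
  have "computable (Suc k) (\<lambda>xs. f (map (\<lambda>g. g xs) ?projs))"
    by (rule computable_comp) (use assms in \<open>auto intro: computable_nth\<close>)
  moreover have "map (\<lambda>g. g xs) ?projs = tl xs" if "length xs = Suc k" for xs
    using that by (auto intro!: nth_equalityI simp: nth_tl)
  ultimately show ?thesis by (simp cong: computable_cong)
qed

lemma computable_Suc:
  assumes "computable k f"
  shows "computable k (\<lambda>xs. Suc (f xs))"
proof -
  have "computable 1 (\<lambda>xs. Suc (xs ! 0))"
    unfolding computable_def by (rule exI[of _ Succ]) (auto simp: length_Suc_conv intro: ev_succ)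
  then show ?thesis using computable_comp[of "[f]" "\<lambda>xs. Suc (xs ! 0)"] assms by simp
qed

lemma computable_const: "computable k (\<lambda>xs. c)"
proof (induction c)
  case 0
  show ?case unfolding computable_def by (rule exI[of _ Zero]) (auto intro: ev_zero)
qed (rule computable_Suc)

lemma computable_rec_nat:
  assumes f: "computable k f" and g: "computable (Suc (Suc k)) g" and n: "computable k n"
  shows "computable k (\<lambda>xs. rec_nat (f xs) (\<lambda>m r. g (m # r # xs)) (n xs))"
proof -
  let ?projs = "map (\<lambda>i xs. xs ! i) [0..<k] :: (nat list \<Rightarrow> nat) list"
  let ?h = "\<lambda>xs. rec_nat (f (tl xs)) (\<lambda>m r. g (m # r # tl xs)) (xs ! 0)"
  obtain e d where e: "oracle_free e" "\<And>A xs. length xs = k \<Longrightarrow> ev A e xs (f xs) []"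
    and d: "oracle_free d" "\<And>A xs. length xs = Suc (Suc k) \<Longrightarrow> ev A d xs (g xs) []"
    using f g by (auto simp: computable_def)
  have "ev A (PrimRec e d) (n # xs) (rec_nat (f xs) (\<lambda>m r. g (m # r # xs)) n) []"
    if "length xs = k" for A n xs
    by (induction n) (use e d that in \<open>auto intro!: ev_query_free_intros\<close>)
  then have "computable (Suc k) ?h"
    unfolding computable_def using e d
    by (intro exI[of _ "PrimRec e d"]) (auto simp: length_Suc_conv)
  moreover have "\<forall>g\<in>set (n # ?projs). computable k g"
    using n by (auto intro: computable_nth)
  ultimately have "computable k (\<lambda>xs. ?h (map (\<lambda>g. g xs) (n # ?projs)))"
    by (intro computable_comp) auto
  moreover have "map (\<lambda>g. g xs) ?projs = xs" if "length xs = k" for xs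
    using that by (auto intro: nth_equalityI)
  ultimately show ?thesis by (simp cong: computable_cong)
qed

lemma computable_funpow:
  assumes f: "computable (Suc k) (\<lambda>xs. f (tl xs) (xs ! 0))"
    and n: "computable k n" and a: "computable k a"
  shows "computable k (\<lambda>xs. (f xs ^^ n xs) (a xs))"
proof -
  have "computable (Suc (Suc k)) (\<lambda>xs. f (tl (tl xs)) (tl xs ! 0))"
    using computable_tl[OF f] .
  from computable_rec_nat[OF a this n]
  have "computable k (\<lambda>xs. rec_nat (a xs) (\<lambda>m r. f xs r) (n xs))" by simp
  moreover have "rec_nat b (\<lambda>m r. g r) i = (g ^^ i) b" for g and b i :: nat
    by (induction i) auto
  ultimately show ?thesis by simp
qed

lemma computable_diff_one:
  assumes "computable k f"
  shows "computable k (\<lambda>xs. f xs - 1)"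
proof -
  have "computable k (\<lambda>xs. rec_nat 0 (\<lambda>m r. (m # r # xs) ! 0) (f xs))"
    by (intro computable_rec_nat computable_const computable_nth assms) auto
  moreover have "rec_nat 0 (\<lambda>m r. m) n = n - 1" for n :: nat by (cases n) auto
  ultimately show ?thesis by simp
qed

lemma computable_add:
  assumes "computable k f" "computable k g"
  shows "computable k (\<lambda>xs. f xs + g xs)"
proof -
  have "computable k (\<lambda>xs. (Suc ^^ g xs) (f xs))"
    by (intro computable_funpow computable_Suc computable_nth assms) auto
  then show ?thesis by (simp add: add.commute)
qed

lemma computable_diff:
  assumes "computable k f" "computable k g"
  shows "computable k (\<lambda>xs. f xs - g xs)"
proof -
  have "computable k (\<lambda>xs. ((\<lambda>x. x - 1) ^^ g xs) (f xs))"
    by (intro computable_funpow computable_diff_one computable_nth assms) auto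
  moreover have "((\<lambda>x. x - 1) ^^ n) m = m - n" for m n :: nat by (induction n) auto
  ultimately show ?thesis by simp
qed

lemma computable_mult:
  assumes "computable k f" "computable k g"
  shows "computable k (\<lambda>xs. f xs * g xs)"
proof -
  have "computable k (\<lambda>xs. ((+) (f xs) ^^ g xs) 0)"
    by (intro computable_funpow computable_add computable_tl computable_nth computable_const assms)
      auto
  moreover have "((+) m ^^ n) 0 = m * n" for m n :: nat by (induction n) auto
  ultimately show ?thesis by simp
qed

lemma computable_power:
  assumes "computable k f" "computable k g"
  shows "computable k (\<lambda>xs. f xs ^ g xs)"
proof -
  have "computable k (\<lambda>xs. ((*) (f xs) ^^ g xs) 1)"
    by (intro computable_funpow computable_mult computable_tl computable_nth computable_const assms)
      auto
  moreover have "((*) m ^^ n) 1 = m ^ n" for m n :: nat by (induction n) auto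
  ultimately show ?thesis by simp
qed

lemma computable_triangle:
  assumes "computable k f"
  shows "computable k (\<lambda>xs. triangle (f xs))"
proof -
  have "computable k (\<lambda>xs. rec_nat 0 (\<lambda>m r. (m # r # xs) ! 1 + Suc ((m # r # xs) ! 0)) (f xs))"
    by (intro computable_rec_nat computable_add computable_Suc computable_const computable_nth
        assms) auto
  moreover have "rec_nat 0 (\<lambda>m r. r + Suc m) n = triangle n" for n by (induction n) auto
  ultimately show ?thesis by simp
qed

lemma computable_prod_encode:
  assumes "computable k f" "computable k g"
  shows "computable k (\<lambda>xs. prod_encode (f xs, g xs))"
  unfolding prod_encode_def prod.case by (intro computable_add computable_triangle assms)

definition decidable :: "nat \<Rightarrow> (nat list \<Rightarrow> bool) \<Rightarrow> bool" where
  "decidable k P \<longleftrightarrow> computable k (\<lambda>xs. of_bool (P xs))"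

lemma computable_If:
  assumes P: "decidable k P" and f: "computable k f" and g: "computable k g"
  shows "computable k (\<lambda>xs. if P xs then f xs else g xs)"
proof -
  from computable_rec_nat[OF g computable_tl[OF computable_tl[OF f]] P[unfolded decidable_def]]
  have "computable k (\<lambda>xs. rec_nat (g xs) (\<lambda>m r. f xs) (of_bool (P xs)))" by simp
  moreover have "rec_nat b (\<lambda>m r. a) (of_bool p) = (if p then a else b)" for a b :: nat and p
    by (cases p) auto
  ultimately show ?thesis by simp
qed

lemma decidable_If:
  assumes "decidable k P" "decidable k Q" "decidable k R"
  shows "decidable k (\<lambda>xs. if P xs then Q xs else R xs)"
  using computable_If[OF assms(1)] assms(2,3) unfolding decidable_def if_distrib[of of_bool] .

lemma decidable_const: "decidable k (\<lambda>xs. b)"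
  unfolding decidable_def by (rule computable_const)

lemma decidable_not: "decidable k P \<Longrightarrow> decidable k (\<lambda>xs. \<not> P xs)"
  using decidable_If[of k P "\<lambda>xs. False" "\<lambda>xs. True"]
  by (simp add: decidable_const if_bool_eq_conj)

lemma decidable_conj: "decidable k P \<Longrightarrow> decidable k Q \<Longrightarrow> decidable k (\<lambda>xs. P xs \<and> Q xs)"
  using decidable_If[of k P Q "\<lambda>xs. False"]
  by (simp add: decidable_const if_bool_eq_disj)

lemma decidable_less:
  assumes "computable k f" "computable k g"
  shows "decidable k (\<lambda>xs. f xs < g xs)"
proof -
  have "of_bool (f xs < g xs) = 1 - (Suc (f xs) - g xs)" for xs by auto
  then show ?thesis
    unfolding decidable_def
    by (simp only:) (intro computable_diff computable_Suc computable_const assms)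
qed

lemma decidable_eq:
  assumes "computable k f" "computable k g"
  shows "decidable k (\<lambda>xs. f xs = g xs)"
proof -
  have "f xs = g xs \<longleftrightarrow> \<not> f xs < g xs \<and> \<not> g xs < f xs" for xs by auto
  then show ?thesis by (simp only:) (intro decidable_conj decidable_not decidable_less assms)
qed

lemma computable_Least:
  assumes P: "decidable (Suc k) P" and ex: "\<And>xs. length xs = k \<Longrightarrow> \<exists>n. P (n # xs)"
  shows "computable k (\<lambda>xs. LEAST n. P (n # xs))"
proof -
  have "computable (Suc k) (\<lambda>xs. of_bool (\<not> P xs))"
    using decidable_not[OF P] by (simp add: decidable_def)
  then obtain e where "oracle_free e"
    "\<And>A xs. length xs = Suc k \<Longrightarrow> ev A e xs (of_bool (\<not> P xs)) []"
    by (auto simp: computable_def)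
  then have "ev A (Mu e) xs (LEAST n. P (n # xs)) []" if "length xs = k" for A xs
    using ev_Mu_Least[of A e xs "\<lambda>n. of_bool (\<not> P (n # xs))"] ex that by simp
  with \<open>oracle_free e\<close> show ?thesis
    unfolding computable_def by (intro exI[of _ "Mu e"]) auto
qed

abbreviation pfst :: "nat \<Rightarrow> nat" where "pfst z \<equiv> fst (prod_decode z)"
abbreviation psnd :: "nat \<Rightarrow> nat" where "psnd z \<equiv> snd (prod_decode z)"

lemma triangle_mono: "m \<le> n \<Longrightarrow> triangle m \<le> triangle n"
  by (induction rule: dec_induct) auto

lemma triangle_prod_decode: "triangle (pfst z + psnd z) + pfst z = z"
  using prod_decode_inverse[of z] by (cases "prod_decode z") (simp add: prod_encode_def)

lemma Least_triangle_greater: "(LEAST w. z < triangle (Suc w)) = pfst z + psnd z"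
proof (rule Least_equality)
  show "z < triangle (Suc (pfst z + psnd z))" using triangle_prod_decode[of z] by simp
  show "pfst z + psnd z \<le> w" if "z < triangle (Suc w)" for w
  proof (rule ccontr)
    assume "\<not> ?thesis"
    then have "triangle (Suc w) \<le> triangle (pfst z + psnd z)" by (intro triangle_mono) simp
    with that triangle_prod_decode[of z] show False by linarith
  qed
qed

lemma computable_pfst_plus_psnd:
  assumes "computable k f"
  shows "computable k (\<lambda>xs. pfst (f xs) + psnd (f xs))"
proof -
  have "computable k (\<lambda>xs. LEAST w. f (tl (w # xs)) < triangle (Suc ((w # xs) ! 0)))"
  proof (rule computable_Least)
    show "decidable (Suc k) (\<lambda>xs. f (tl xs) < triangle (Suc (xs ! 0)))"
      by (intro decidable_less computable_triangle computable_Suc computable_tl computable_nth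
          assms) simp
    show "\<exists>w. f (tl (w # xs)) < triangle (Suc ((w # xs) ! 0))" for xs
      by (rule exI[of _ "f xs"]) simp
  qed
  then show ?thesis by (simp add: Least_triangle_greater del: triangle_Suc)
qed

lemma computable_pfst:
  assumes "computable k f"
  shows "computable k (\<lambda>xs. pfst (f xs))"
proof -
  have "computable k (\<lambda>xs. f xs - triangle (pfst (f xs) + psnd (f xs)))"
    by (intro computable_diff computable_triangle computable_pfst_plus_psnd assms)
  moreover have "z - triangle (pfst z + psnd z) = pfst z" for z
    using triangle_prod_decode[of z] by linarith
  ultimately show ?thesis by simp
qed

lemma computable_psnd:
  assumes "computable k f"
  shows "computable k (\<lambda>xs. psnd (f xs))"
proof -
  have "computable k (\<lambda>xs. pfst (f xs) + psnd (f xs) - pfst (f xs))"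
    by (intro computable_diff computable_pfst_plus_psnd computable_pfst assms)
  then show ?thesis by simp
qed

lemmas computable_intros =
  computable_const computable_Suc computable_diff_one computable_add computable_power
  computable_prod_encode computable_pfst computable_psnd computable_If
  decidable_const decidable_not decidable_conj decidable_If decidable_less decidable_eq

lemma computable_unaryE:
  assumes "computable 1 (\<lambda>xs. g (xs ! 0))"
  obtains e where "oracle_free e" "\<And>A x. ev A e [x] (g x) []"
proof -
  from assms obtain e where "oracle_free e"
    and e: "\<And>A xs. length xs = 1 \<Longrightarrow> ev A e xs (g (xs ! 0)) []"
    by (auto simp: computable_def)
  moreover have "ev A e [x] (g x) []" for A x using e[of "[x]" A] by simp
  ultimately show thesis using that by blast
qed

lemma indexed_familyI:
  assumes R: "decidable 3 (\<lambda>xs. R (xs ! 0) (xs ! 1) (xs ! 2))"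
    and F: "\<And>n x. x \<in> F n \<longleftrightarrow> (\<exists>k. R k n x)"
  shows "indexed_family F"
proof -
  have "computable 3 (\<lambda>xs. of_bool (\<not> R (xs ! 0) (xs ! 1) (xs ! 2)))"
    using decidable_not[OF R] by (simp add: decidable_def)
  then obtain e where "oracle_free e"
    and e: "\<And>A xs. length xs = 3 \<Longrightarrow> ev A e xs (of_bool (\<not> R (xs ! 0) (xs ! 1) (xs ! 2))) []"
    by (auto simp: computable_def)
  have ev: "ev A e [k, n, x] (of_bool (\<not> R k n x)) []" for A k n x
    using e[of "[k, n, x]" A] by simp
  have "(\<exists>k. R k n x) \<longleftrightarrow> (\<exists>y q. ev {} (Mu e) [n, x] y q)" for n x
  proof
    assume "\<exists>k. R k n x"
    with ev_Mu_Least[of "{}" e "[n, x]", OF ev] show "\<exists>y q. ev {} (Mu e) [n, x] y q" by auto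
  next
    assume "\<exists>y q. ev {} (Mu e) [n, x] y q"
    then obtain y q where "ev {} e [y, n, x] 0 q"
      by (auto elim!: ev_elims dest: evmu_imp_zero)
    with ev_deterministic(1)[OF ev this] show "\<exists>k. R k n x" by auto
  qed
  with \<open>oracle_free e\<close> F show ?thesis
    unfolding indexed_family_def by (intro exI[of _ "Mu e"]) auto
qed

lemma teacherI:
  assumes "computable 1 (\<lambda>xs. g (xs ! 0))" and g: "\<And>\<sigma>. list_encode (T \<sigma>) = g (list_encode \<sigma>)"
    and "\<And>\<sigma> \<tau>. prefix (T \<sigma>) (T (\<sigma> @ \<tau>))" "\<And>\<sigma>. set (T \<sigma>) \<subseteq> set \<sigma>"
  shows "teacher T"
proof -
  obtain t where "oracle_free t" "\<And>A x. ev A t [x] (g x) []"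
    using computable_unaryE assms(1) by blast
  then have "\<exists>t. oracle_free t \<and> (\<forall>\<sigma>. \<exists>q. ev {} t [list_encode \<sigma>] (list_encode (T \<sigma>)) q)"
    unfolding g by blast
  then show ?thesis
    using assms(3,4) unfolding teacher_def prefix_def by blast
qed

section \<open>A teacher that passes on one witness\<close>

abbreviation lcons :: "nat \<Rightarrow> nat \<Rightarrow> nat" where "lcons a c \<equiv> Suc (prod_encode (a, c))"
abbreviation lhd :: "nat \<Rightarrow> nat" where "lhd c \<equiv> pfst (c - 1)"
abbreviation ltl :: "nat \<Rightarrow> nat" where "ltl c \<equiv> psnd (c - 1)"

lemma prefix_take_mono: "prefix xs ys \<Longrightarrow> prefix (take n xs) (take n ys)"
  by (auto simp: prefix_def)

lemma length_le_list_encode: "length \<sigma> \<le> list_encode \<sigma>"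
proof (induction \<sigma>)
  case (Cons x \<sigma>)
  then show ?case using le_prod_encode_2[of "list_encode \<sigma>" x] by simp
qed simp

lemma list_encode_eq_0_iff: "list_encode \<sigma> = 0 \<longleftrightarrow> \<sigma> = []"
  by (cases \<sigma>) auto

definition witness_teacher :: "(nat \<Rightarrow> bool) \<Rightarrow> nat list \<Rightarrow> nat list" where
  "witness_teacher P \<sigma> = take 1 \<sigma> @ take 1 (filter P \<sigma>)"

definition drop_unless :: "(nat \<Rightarrow> bool) \<Rightarrow> nat \<Rightarrow> nat" where
  "drop_unless P c = (if c = 0 then 0 else if P (lhd c) then c else ltl c)"

lemma drop_unless_funpow:
  "length \<sigma> \<le> k \<Longrightarrow>
     (drop_unless P ^^ k) (list_encode \<sigma>) = list_encode (dropWhile (\<lambda>x. \<not> P x) \<sigma>)"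
proof (induction \<sigma> arbitrary: k)
  case Nil
  show ?case by (induction k) (auto simp: drop_unless_def)
next
  case (Cons x \<sigma>)
  show ?case
  proof (cases "P x")
    case True
    then have "(drop_unless P ^^ k) (list_encode (x # \<sigma>)) = list_encode (x # \<sigma>)"
      by (induction k) (auto simp: drop_unless_def)
    with True show ?thesis by simp
  next
    case False
    then have "drop_unless P (list_encode (x # \<sigma>)) = list_encode \<sigma>"
      by (simp add: drop_unless_def)
    with Cons False show ?thesis
      by (cases k) (simp_all add: funpow_Suc_right del: funpow.simps list_encode.simps)
  qed
qed

lemma take_1_filter_conv_dropWhile: "take 1 (filter P xs) = take 1 (dropWhile (\<lambda>x. \<not> P x) xs)"
  by (induction xs) auto

lemma teacher_witness_teacher:
  assumes "\<And>k f. computable k f \<Longrightarrow> decidable k (\<lambda>xs. P (f xs))"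
  shows "teacher (witness_teacher P)"
proof (rule teacherI)
  let ?rest = "\<lambda>c. (drop_unless P ^^ c) c"
  let ?g = "\<lambda>c. if c = 0 then 0
    else lcons (lhd c) (if ?rest c = 0 then 0 else lcons (lhd (?rest c)) 0)"
  have "computable 1 (\<lambda>xs. ?rest (xs ! 0))"
    unfolding drop_unless_def
    by (intro computable_funpow computable_intros computable_nth assms) auto
  then show "computable 1 (\<lambda>xs. ?g (xs ! 0))"
    by (intro computable_intros computable_nth) auto
  show "list_encode (witness_teacher P \<sigma>) = ?g (list_encode \<sigma>)" for \<sigma>
    unfolding drop_unless_funpow[OF length_le_list_encode] witness_teacher_def
      take_1_filter_conv_dropWhile
    by (cases \<sigma>; cases "dropWhile (\<lambda>x. \<not> P x) \<sigma>") auto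
  show "prefix (witness_teacher P \<sigma>) (witness_teacher P (\<sigma> @ \<tau>))" for \<sigma> \<tau>
    by (cases \<sigma>) (auto simp: witness_teacher_def prefix_take_mono)
  show "set (witness_teacher P \<sigma>) \<subseteq> set \<sigma>" for \<sigma>
    by (auto simp: witness_teacher_def dest!: in_set_takeD)
qed

lemma card_witness_teacher: "card (set (witness_teacher P \<sigma>)) \<le> 2"
  using card_length[of "witness_teacher P \<sigma>"] by (simp add: witness_teacher_def)

lemma witness_teacher_restr:
  "0 < j \<Longrightarrow> witness_teacher P (restr f j) = f 0 # take 1 (filter P (restr f j))"
  by (simp add: witness_teacher_def restr_def take_map take_upt)

lemma filter_restr_eventually:
  obtains n where "\<And>j. j \<ge> n \<Longrightarrow> filter P (restr f j) = [] \<longleftrightarrow> \<not> (\<exists>z\<in>range f. P z)"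
proof (cases "\<exists>k. P (f k)")
  case True
  then obtain k where "P (f k)" by blast
  then show thesis by (intro that[of "Suc k"]) (auto simp: filter_empty_conv restr_def)
next
  case False
  then show thesis by (intro that[of 0]) (auto simp: filter_empty_conv restr_def)
qed

lemma PSD_T_by_witness:
  assumes F: "indexed_family F"
    and P: "\<And>k f. computable k f \<Longrightarrow> decidable k (\<lambda>xs. P (f xs))"
    and g: "\<And>k f. computable k f \<Longrightarrow> computable k (\<lambda>xs. g (f xs))"
    and h: "\<And>k f. computable k f \<Longrightarrow> computable k (\<lambda>xs. h (f xs))"
    and index: "\<And>i x. x \<in> F i \<Longrightarrow> F (if \<exists>z\<in>F i. P z then g x else h x) = F i"
  shows "F \<in> PSD_T"
proof -
  have "computable 1 (\<lambda>xs. if ltl (xs ! 0) = 0 then h (lhd (xs ! 0)) else g (lhd (xs ! 0)))"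
    by (intro computable_intros computable_nth g h) auto
  then obtain M where M: "oracle_free M"
    "\<And>A c. ev A M [c] (if ltl c = 0 then h (lhd c) else g (lhd c)) []"
    by (rule computable_unaryE) blast
  have M_outputs: "outputs A M (x # \<sigma>) (if \<sigma> = [] then h x else g x)" for A x \<sigma>
    using M(2)[of A "list_encode (x # \<sigma>)"] by (auto simp: outputs_def list_encode_eq_0_iff)
  have "psd_crit F M (\<lambda>\<sigma> H. witness_teacher P \<sigma>) [:3:]"
    unfolding psd_crit_iff data_plain_teacher hist_oracle_free[OF M(1)]
  proof (intro allI impI)
    fix i f
    assume "enumeration f (F i)"
    then have range: "range f = F i" by (simp add: enumeration_def)
    define r where "r = (if \<exists>z\<in>F i. P z then g (f 0) else h (f 0))"
    obtain n where n: "\<And>j. j \<ge> n \<Longrightarrow> filter P (restr f j) = [] \<longleftrightarrow> \<not> (\<exists>z\<in>F i. P z)"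
      using filter_restr_eventually[of P f] unfolding range by blast
    have "outputs (F i) M (witness_teacher P (restr f j)) r" if "j \<ge> Suc n" for j
      using M_outputs[of "F i" "f 0" "take 1 (filter P (restr f j))"] n[of j] that
      by (cases "\<exists>z\<in>F i. P z") (auto simp: r_def witness_teacher_restr)
    moreover have "F r = F i" unfolding r_def by (rule index) (simp flip: range)
    ultimately show "\<exists>n r. card (set (witness_teacher P (restr f n))) < poly [:3:] (mi F (F i))
        \<and> length ([] :: (nat \<times> bool) list) < poly [:3:] (mi F (F i))
        \<and> (\<forall>j\<ge>n. outputs (F i) M (witness_teacher P (restr f j)) r) \<and> F r = F i"
      using card_witness_teacher[of P "restr f (Suc n)"]
      by (intro exI[of _ "Suc n"] exI[of _ r]) simp
  qed
  moreover have "teacher (witness_teacher P)" by (rule teacher_witness_teacher) (rule P)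
  ultimately show ?thesis unfolding PSD_T_def using F M(1) by blast
qed

section \<open>A universal machine\<close>

fun encode :: "recf \<Rightarrow> nat" and encode_list :: "recf list \<Rightarrow> nat" where
  "encode Zero = prod_encode (0, 0)"
| "encode Succ = prod_encode (1, 0)"
| "encode (Proj i) = prod_encode (2, i)"
| "encode Oracle = prod_encode (3, 0)"
| "encode (Comp f gs) = prod_encode (4, prod_encode (encode f, encode_list gs))"
| "encode (PrimRec f g) = prod_encode (5, prod_encode (encode f, encode g))"
| "encode (Mu f) = prod_encode (6, encode f)"
| "encode_list [] = prod_encode (0, 0)"
| "encode_list (g # gs) = prod_encode (7, prod_encode (encode g, encode_list gs))"

text \<open>A configuration consists of a register and a stack of tasks. The task \<open>encode f\<close> replaces the
  argument list in the register by the value of \<open>f\<close>; the other tasks are continuations, which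
  remember the argument list \<open>v\<close> while an intermediate value is being computed in the register.
  The empty list of programs may share its code with \<open>Zero\<close>, since its list of values has
  code \<open>0\<close>.\<close>

definition config :: "nat \<Rightarrow> nat list \<Rightarrow> nat" where
  "config v K = prod_encode (v, list_encode K)"

definition rec_cont :: "nat \<Rightarrow> nat \<Rightarrow> nat \<Rightarrow> nat" where
  "rec_cont g m v = prod_encode (8, prod_encode (g, prod_encode (m, v)))"

definition mu_cont :: "nat \<Rightarrow> nat \<Rightarrow> nat \<Rightarrow> nat" where
  "mu_cont f m v = prod_encode (9, prod_encode (f, prod_encode (m, v)))"

definition args_cont :: "nat \<Rightarrow> nat \<Rightarrow> nat" where
  "args_cont gs v = prod_encode (10, prod_encode (gs, v))"

definition cons_cont :: "nat \<Rightarrow> nat" where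
  "cons_cont y = prod_encode (11, y)"

definition execute :: "nat set \<Rightarrow> nat \<Rightarrow> nat \<Rightarrow> nat \<Rightarrow> nat" where
  "execute A t v K = (let a = psnd t; b = psnd a; c = psnd b in
     if pfst t = 0 then prod_encode (0, K)
     else if pfst t = 1 then prod_encode (Suc (lhd v), K)
     else if pfst t = 2 then
       (if a = 0 then prod_encode (lhd v, K)
        else prod_encode (ltl v, lcons (prod_encode (2, a - 1)) K))
     else if pfst t = 3 then prod_encode (if lhd v \<in> A then 1 else 0, K)
     else if pfst t = 4 then prod_encode (v, lcons b (lcons (pfst a) K))
     else if pfst t = 5 then
       (if lhd v = 0 then prod_encode (ltl v, lcons (pfst a) K)
        else prod_encode (lcons (lhd v - 1) (ltl v),
          lcons t (lcons (rec_cont b (lhd v - 1) (ltl v)) K)))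
     else if pfst t = 6 then prod_encode (lcons 0 v, lcons a (lcons (mu_cont a 0 v) K))
     else if pfst t = 7 then prod_encode (v, lcons (pfst a) (lcons (args_cont b v) K))
     else if pfst t = 8 then prod_encode (lcons (pfst b) (lcons v c), lcons (pfst a) K)
     else if pfst t = 9 then
       (if v = 0 then prod_encode (pfst b, K)
        else prod_encode (lcons (Suc (pfst b)) c,
          lcons (pfst a) (lcons (mu_cont (pfst a) (Suc (pfst b)) c) K)))
     else if pfst t = 10 then prod_encode (b, lcons (pfst a) (lcons (cons_cont v) K))
     else prod_encode (lcons a v, K))"

definition step :: "nat set \<Rightarrow> nat \<Rightarrow> nat" where
  "step A s = (if psnd s = 0 then s else execute A (lhd (psnd s)) (pfst s) (ltl (psnd s)))"

lemma step_Nil: "step A (config v []) = config v []"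
  by (simp add: step_def config_def)

lemma step_program:
  "step A (config v (encode Zero # K)) = config 0 K"
  "step A (config v (encode Succ # K)) = config (Suc (lhd v)) K"
  "step A (config v (encode (Proj 0) # K)) = config (lhd v) K"
  "step A (config v (encode (Proj (Suc i)) # K)) = config (ltl v) (encode (Proj i) # K)"
  "step A (config v (encode Oracle # K)) = config (if lhd v \<in> A then 1 else 0) K"
  "step A (config v (encode (Comp f gs) # K)) = config v (encode_list gs # encode f # K)"
  "step A (config (lcons 0 v) (encode (PrimRec f g) # K)) = config v (encode f # K)"
  "step A (config (lcons (Suc m) v) (encode (PrimRec f g) # K)) =
     config (lcons m v) (encode (PrimRec f g) # rec_cont (encode g) m v # K)"
  "step A (config v (encode (Mu f) # K)) =
     config (lcons 0 v) (encode f # mu_cont (encode f) 0 v # K)"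
  "step A (config v (encode_list [] # K)) = config 0 K"
  "step A (config v (encode_list (g # gs) # K)) =
     config v (encode g # args_cont (encode_list gs) v # K)"
  by (simp_all add: step_def execute_def config_def Let_def)

lemma step_continuation:
  "step A (config r (rec_cont g m v # K)) = config (lcons m (lcons r v)) (g # K)"
  "step A (config 0 (mu_cont f m v # K)) = config m K"
  "step A (config (Suc r) (mu_cont f m v # K)) =
     config (lcons (Suc m) v) (f # mu_cont f (Suc m) v # K)"
  "step A (config y (args_cont gs v # K)) = config v (gs # cons_cont y # K)"
  "step A (config v (cons_cont y # K)) = config (lcons y v) K"
  by (simp_all add: step_def execute_def config_def rec_cont_def mu_cont_def args_cont_def
      cons_cont_def)

lemmas [simp del] = encode.simps encode_list.simps

lemma computable_step:
  assumes A: "\<And>f. computable k f \<Longrightarrow> decidable k (\<lambda>xs. f xs \<in> A xs)" and s: "computable k s"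
  shows "computable k (\<lambda>xs. step (A xs) (s xs))"
  unfolding step_def execute_def Let_def rec_cont_def mu_cont_def args_cont_def cons_cont_def
  by (intro computable_intros A s)

definition reaches :: "nat set \<Rightarrow> nat \<Rightarrow> nat \<Rightarrow> bool" where
  "reaches A s s' \<longleftrightarrow> (\<exists>k. (step A ^^ k) s = s')"

lemma reaches_refl: "reaches A s s"
  unfolding reaches_def by (rule exI[of _ 0]) simp

lemma reaches_step: "reaches A (step A s) s' \<Longrightarrow> reaches A s s'"
  unfolding reaches_def by (metis comp_apply funpow_Suc_right)

lemma reaches_trans: "reaches A s s' \<Longrightarrow> reaches A s' s'' \<Longrightarrow> reaches A s s''"
  unfolding reaches_def by (metis comp_apply funpow_add)

lemma halted_unique:
  assumes "(step A ^^ k) s = config y []" "(step A ^^ l) s = config z []"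
  shows "y = z"
proof -
  have halted: "(step A ^^ i) (config v []) = config v []" for i v
    by (induction i) (auto simp: step_Nil)
  have "(step A ^^ (k + l)) s = config z []"
    by (simp add: funpow_add assms(2) halted)
  moreover have "(step A ^^ (k + l)) s = config y []"
    by (simp add: add.commute[of k] funpow_add assms(1) halted)
  ultimately show ?thesis by (simp add: config_def)
qed

lemma reaches_Proj:
  "i < length xs \<Longrightarrow> reaches A (config (list_encode xs) (encode (Proj i) # K)) (config (xs ! i) K)"
proof (induction i arbitrary: xs)
  case 0
  then obtain x ys where "xs = x # ys" by (cases xs) auto
  show ?case by (rule reaches_step) (simp add: \<open>xs = x # ys\<close> step_program reaches_refl)
next
  case (Suc i)
  then obtain x ys where "xs = x # ys" by (cases xs) auto
  show ?case
    by (rule reaches_step) (use Suc \<open>xs = x # ys\<close> in \<open>simp add: step_program\<close>)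
qed

lemma reaches_args_cont:
  assumes "\<And>K. reaches A (config v (encode_list gs # K)) (config (list_encode ys) K)"
  shows "reaches A (config y (args_cont (encode_list gs) v # K)) (config (list_encode (y # ys)) K)"
proof -
  have "reaches A (config y (args_cont (encode_list gs) v # K))
      (config (list_encode ys) (cons_cont y # K))"
    by (rule reaches_step) (simp add: step_continuation assms)
  moreover have "reaches A (config (list_encode ys) (cons_cont y # K))
      (config (list_encode (y # ys)) K)"
    by (rule reaches_step) (simp add: step_continuation reaches_refl)
  ultimately show ?thesis by (rule reaches_trans)
qed

lemma reaches_value:
  "ev A f xs y q \<Longrightarrow> reaches A (config (list_encode xs) (encode f # K)) (config y K)"
  "evs A gs xs ys q \<Longrightarrow>
     reaches A (config (list_encode xs) (encode_list gs # K)) (config (list_encode ys) K)"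
  "evmu A f xs m y q \<Longrightarrow>
     reaches A
      (config (list_encode (m # xs)) (encode f # mu_cont (encode f) m (list_encode xs) # K))
      (config y K)"
proof (induction arbitrary: K and K and K rule: ev_evs_evmu.inducts)
  case (ev_proj i xs)
  then show ?case by (rule reaches_Proj)
next
  case (ev_comp gs xs ys qs f y q)
  show ?case
    by (rule reaches_step) (use ev_comp.IH in \<open>auto simp: step_program intro: reaches_trans\<close>)
next
  case (ev_primS f g m xs r q y q')
  have "reaches A (config (list_encode (Suc m # xs)) (encode (PrimRec f g) # K))
      (config r (rec_cont (encode g) m (list_encode xs) # K))"
    by (rule reaches_step) (use ev_primS.IH in \<open>simp add: step_program\<close>)
  moreover have "reaches A (config r (rec_cont (encode g) m (list_encode xs) # K)) (config y K)"
    by (rule reaches_step) (use ev_primS.IH in \<open>simp add: step_continuation\<close>)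
  ultimately show ?case by (rule reaches_trans)
next
  case (evs_cons g xs y q gs ys qs)
  have "reaches A (config (list_encode xs) (encode_list (g # gs) # K))
      (config y (args_cont (encode_list gs) (list_encode xs) # K))"
    by (rule reaches_step) (use evs_cons.IH in \<open>simp add: step_program\<close>)
  moreover have "reaches A (config y (args_cont (encode_list gs) (list_encode xs) # K))
      (config (list_encode (y # ys)) K)"
    using evs_cons.IH by (intro reaches_args_cont)
  ultimately show ?case by (rule reaches_trans)
next
  case (evmu_found f m xs q)
  have "reaches A (config 0 (mu_cont (encode f) m (list_encode xs) # K)) (config m K)"
    by (rule reaches_step) (simp add: step_continuation reaches_refl)
  with evmu_found.IH show ?case using reaches_trans by blast
next
  case (evmu_next f m xs k q y q')
  have "reaches A (config (Suc k) (mu_cont (encode f) m (list_encode xs) # K)) (config y K)"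
    by (rule reaches_step) (use evmu_next.IH in \<open>simp add: step_continuation\<close>)
  with evmu_next.IH show ?case using reaches_trans by blast
qed (rule reaches_step, force simp: step_program reaches_refl)+

section \<open>The diagonal family\<close>

definition column :: "nat \<Rightarrow> nat set" where
  "column n = {z. pfst z = n}"

definition bound :: "nat \<Rightarrow> nat" where
  "bound n = (prod_encode (n, 1) + 2) ^ psnd n"

definition probe :: "nat \<Rightarrow> nat list" where
  "probe n = rev (map (\<lambda>k. prod_encode (n, k)) [0..<bound n])"

definition start :: "nat \<Rightarrow> nat" where
  "start n = config (list_encode [list_encode (probe n)]) [pfst n]"

text \<open>Index \<open>n\<close> stands for the learner with code \<open>pfst n\<close> together with the polynomial bound
  \<open>\<lambda>m. (m + 2) ^ psnd n\<close>. The indices \<open>prod_encode (n, b)\<close> with \<open>b = 0\<close> and with \<open>b \<noteq> 0\<close> are two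
  competing hypotheses for \<open>column n\<close>. If the learner, run on \<open>probe n\<close>, chooses \<open>b \<noteq> 0\<close>,
  then the elements of \<open>column n\<close> that code a time at which this run has halted are marked and are
  missing from that hypothesis; otherwise nothing is marked and the hypothesis with \<open>b = 0\<close> is
  empty.\<close>

definition marked :: "nat \<Rightarrow> bool" where
  "marked z \<longleftrightarrow>
     (\<exists>r. (step (column (pfst z)) ^^ psnd z) (start (pfst z)) = config r [] \<and> psnd r \<noteq> 0)"

definition diag_family :: "nat \<Rightarrow> nat set" where
  "diag_family i = {z \<in> column (pfst i).
     if psnd i = 0 then \<exists>w\<in>column (pfst i). marked w else \<not> marked z}"

lemma decidable_column:
  "computable k f \<Longrightarrow> computable k n \<Longrightarrow> decidable k (\<lambda>xs. f xs \<in> column (n xs))"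
  unfolding column_def mem_Collect_eq by (intro computable_intros)

lemma computable_bound: "computable k f \<Longrightarrow> computable k (\<lambda>xs. bound (f xs))"
  unfolding bound_def by (intro computable_intros)

lemma computable_probe:
  assumes "computable k f"
  shows "computable k (\<lambda>xs. list_encode (probe (f xs)))"
proof -
  have "computable k (\<lambda>xs. rec_nat 0
      (\<lambda>m r. lcons (prod_encode (f (tl (tl (m # r # xs))), (m # r # xs) ! 0)) ((m # r # xs) ! 1))
      (bound (f xs)))"
    by (intro computable_rec_nat computable_intros computable_nth computable_bound computable_tl
        assms) auto
  moreover have "rec_nat 0 (\<lambda>m r. lcons (prod_encode (n, m)) r) b =
      list_encode (rev (map (\<lambda>k. prod_encode (n, k)) [0..<b]))" for n b
    by (induction b) auto
  ultimately show ?thesis by (simp add: probe_def)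
qed

lemma computable_start: "computable k f \<Longrightarrow> computable k (\<lambda>xs. start (f xs))"
  unfolding start_def config_def list_encode.simps by (intro computable_intros computable_probe)

lemma decidable_marked:
  assumes "computable k f"
  shows "decidable k (\<lambda>xs. marked (f xs))"
proof -
  have "computable k (\<lambda>xs. (step (column (pfst (f xs))) ^^ psnd (f xs)) (start (pfst (f xs))))"
    (is "computable k ?s")
    by (intro computable_funpow computable_step decidable_column computable_start computable_psnd
        computable_pfst computable_tl computable_nth assms) auto
  moreover have "(\<exists>r. s = config r [] \<and> psnd r \<noteq> 0) \<longleftrightarrow> psnd s = 0 \<and> psnd (pfst s) \<noteq> 0" for s
    by (metis config_def fst_conv list_encode.simps(1) prod.collapse prod_decode_inverse
        prod_encode_inverse snd_conv)
  ultimately show ?thesis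
    unfolding marked_def by (simp only:) (intro computable_intros)
qed

lemma indexed_family_diag: "indexed_family diag_family"
proof (rule indexed_familyI)
  show "decidable 3 (\<lambda>xs. xs ! 2 \<in> column (pfst (xs ! 1)) \<and>
      (if psnd (xs ! 1) = 0 then xs ! 0 \<in> column (pfst (xs ! 1)) \<and> marked (xs ! 0)
       else \<not> marked (xs ! 2)))"
    by (intro computable_intros decidable_column decidable_marked computable_nth) auto
qed (auto simp: diag_family_def)

lemma prod_encode_in_column: "prod_encode (n, k) \<in> column n"
  by (simp add: column_def)

lemma diag_family_eq_column_iff:
  "diag_family i = column n \<longleftrightarrow>
     pfst i = n \<and> (psnd i = 0 \<longleftrightarrow> (\<exists>z\<in>column n. marked z))"
proof -
  have "pfst i = n" if "diag_family i = column n"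
  proof -
    have "prod_encode (n, 0) \<in> diag_family i" by (simp add: that prod_encode_in_column)
    then show ?thesis by (simp add: diag_family_def column_def)
  qed
  moreover have "diag_family i = column n \<longleftrightarrow> (psnd i = 0 \<longleftrightarrow> (\<exists>z\<in>column n. marked z))"
    if "pfst i = n"
    unfolding diag_family_def that using prod_encode_in_column[of n 0]
    by (cases "psnd i = 0") auto
  ultimately show ?thesis by metis
qed

lemma column_in_diag_family:
  obtains i where "i \<le> prod_encode (n, 1)" "diag_family i = column n"
proof
  let ?i = "prod_encode (n, if \<exists>z\<in>column n. marked z then 0 else 1)"
  show "?i \<le> prod_encode (n, 1)" by (simp add: prod_encode_def)
  show "diag_family ?i = column n" by (simp add: diag_family_eq_column_iff)
qed

lemma ex_marked_iff:
  assumes "outputs (column n) M (probe n) r" and n: "pfst n = encode M"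
  shows "(\<exists>z\<in>column n. marked z) \<longleftrightarrow> psnd r \<noteq> 0"
proof -
  from assms obtain t where t: "(step (column n) ^^ t) (start n) = config r []"
    using reaches_value(1) by (fastforce simp: outputs_def reaches_def start_def)
  show ?thesis
  proof
    assume "\<exists>z\<in>column n. marked z"
    then show "psnd r \<noteq> 0"
      using halted_unique[OF t] by (auto simp: marked_def column_def)
  next
    assume "psnd r \<noteq> 0"
    with t have "marked (prod_encode (n, t))" by (auto simp: marked_def)
    then show "\<exists>z\<in>column n. marked z" using prod_encode_in_column by blast
  qed
qed

lemma wrong_hypothesis_on_probe:
  "outputs (column n) M (probe n) r \<Longrightarrow> pfst n = encode M \<Longrightarrow> diag_family r \<noteq> column n"
  by (simp add: diag_family_eq_column_iff ex_marked_iff)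

lemma poly_le_power: "\<exists>d. \<forall>m. poly p m \<le> (m + 2) ^ d" for p :: "nat poly"
proof (induction p rule: pCons_induct)
  case (pCons a p)
  then obtain d where d: "\<And>m. poly p m \<le> (m + 2) ^ d" by blast
  have "poly (pCons a p) m \<le> (m + 2) ^ (a + d + 1)" for m
  proof -
    have "a \<le> (m + 2) ^ a"
      using power_mono[of 2 "m + 2" a] less_exp[of a] by linarith
    also have "\<dots> \<le> (m + 2) ^ (a + d)" by (intro power_increasing) auto
    finally have "a \<le> (m + 2) ^ (a + d)" .
    moreover have "poly p m \<le> (m + 2) ^ (a + d)"
      by (rule order_trans[OF d power_increasing]) auto
    ultimately have "a + m * poly p m \<le> (m + 2) ^ (a + d) + m * (m + 2) ^ (a + d)"
      by (intro add_mono mult_le_mono2)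
    also have "\<dots> \<le> (m + 2) ^ (a + d + 1)" by simp
    finally show ?thesis by simp
  qed
  then show ?case by blast
qed simp

lemma enumeration_probe_conc: "enumeration (probe n \<frown> (\<lambda>k. prod_encode (n, k))) (column n)"
proof -
  have "range (\<lambda>k. prod_encode (n, k)) = column n"
    by (auto simp: column_def image_iff) (metis prod.collapse prod_decode_inverse)
  moreover have "set (probe n) \<subseteq> column n" by (auto simp: probe_def column_def)
  ultimately show ?thesis using prod_encode_in_column by (auto simp: enumeration_def)
qed

lemma card_set_probe: "card (set (probe n)) = bound n"
  by (simp add: probe_def card_image inj_on_def)

lemma diag_family_not_PSD_O: "diag_family \<notin> PSD_O"
proof
  assume "diag_family \<in> PSD_O"
  then obtain M p where crit: "psd_crit diag_family M (\<lambda>\<sigma> H. \<sigma>) p"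
    by (auto simp: PSD_O_def)
  obtain d where d: "\<And>m. poly p m \<le> (m + 2) ^ d"
    using poly_le_power by blast
  define n where "n = prod_encode (encode M, d)"
  obtain i where i: "i \<le> prod_encode (n, 1)" "diag_family i = column n"
    by (rule column_in_diag_family)
  define f where "f = probe n \<frown> (\<lambda>k. prod_encode (n, k))"
  have f: "enumeration f (diag_family i)"
    using enumeration_probe_conc by (simp add: f_def i(2))
  have probe: "restr f (length (probe n)) = probe n"
    using restr_conc[of "probe n" _ 0] by (simp add: f_def restr_def)
  have "poly p (mi diag_family (diag_family i)) \<le> (mi diag_family (diag_family i) + 2) ^ d"
    by (rule d)
  also have "\<dots> \<le> (prod_encode (n, 1) + 2) ^ d"
    using order_trans[OF mi_le i(1)] by (intro power_mono) simp_all
  also have "\<dots> = bound n" by (simp add: bound_def n_def)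
  finally obtain r where "outputs (column n) M (probe n) r" "diag_family r = column n"
    using psd_crit_decided[OF crit f, of "length (probe n)"]
    by (auto simp: probe card_set_probe i(2))
  then show False using wrong_hypothesis_on_probe by (simp add: n_def)
qed

lemma diag_family_PSD_T: "diag_family \<in> PSD_T"
proof (rule PSD_T_by_witness[where P = marked
      and g = "\<lambda>x. prod_encode (pfst x, 0)" and h = "\<lambda>x. prod_encode (pfst x, 1)"])
  fix i x
  assume "x \<in> diag_family i"
  then show "diag_family (if \<exists>z\<in>diag_family i. marked z
      then prod_encode (pfst x, 0) else prod_encode (pfst x, 1)) = diag_family i"
    by (auto simp: diag_family_def column_def)
qed (assumption | rule indexed_family_diag decidable_marked computable_prod_encode
    computable_pfst computable_const)+

section \<open>Identification in the limit\<close>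

definition identifies :: "(nat list \<Rightarrow> nat) \<Rightarrow> (nat \<Rightarrow> nat set) \<Rightarrow> nat set \<Rightarrow> bool" where
  "identifies h F L \<longleftrightarrow>
     (\<forall>f. enumeration f L \<longrightarrow> (\<exists>n r. F r = L \<and> (\<forall>j\<ge>n. h (restr f j) = r)))"

lemma enumeration_exists:
  assumes "L \<noteq> {}"
  obtains f where "enumeration f L"
proof -
  from assms obtain a where "a \<in> L" by blast
  then have "enumeration (\<lambda>x. if x \<in> L then x else a) L" by (auto simp: enumeration_def)
  with that show thesis .
qed

lemma prefix_chain_limit:
  assumes chain: "\<And>m. strict_prefix (S m) (S (Suc m))"
  obtains f where "\<And>m. restr f (length (S m)) = S m" "range f = (\<Union>m. set (S m))"
    "\<And>m. m \<le> length (S m)"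
proof
  have mono: "prefix (S m) (S n)" if "m \<le> n" for m n
    using that
  proof (induction rule: dec_induct)
    case (step n)
    with chain[of n] show ?case by (meson prefix_order.less_imp_le prefix_order.trans)
  qed simp
  show length: "m \<le> length (S m)" for m
  proof (induction m)
    case (Suc m)
    with prefix_length_less[OF chain[of m]] show ?case by simp
  qed simp
  define f where "f i = S (Suc i) ! i" for i
  have "f i = S m ! i" if "i < length (S m)" for i m
    using that mono[of m "Suc i"] mono[of "Suc i" m] length[of "Suc i"]
    by (cases "m \<le> Suc i") (auto simp: f_def prefix_def nth_append)
  then show restr: "restr f (length (S m)) = S m" for m
    by (intro nth_equalityI) (auto simp: restr_def)
  have "set (S m) = f ` {..<length (S m)}" for m
    using arg_cong[OF restr, of set] by (simp add: restr_def lessThan_atLeast0)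
  moreover have "(\<Union>m. {..<length (S m)}) = UNIV"
    using length Suc_le_lessD by blast
  ultimately show "range f = (\<Union>m. set (S m))"
    using image_UN[of f "\<lambda>m. {..<length (S m)}" UNIV] by simp
qed

lemma restr_eq_appendD: "restr f (length (\<sigma> @ \<tau>)) = \<sigma> @ \<tau> \<Longrightarrow> restr f (length \<sigma>) = \<sigma>"
  unfolding restr_def length_append upt_add_eq_append[OF le0] map_append by simp

lemma locking_sequence:
  assumes "L \<noteq> {}"
    and converges: "\<And>f. enumeration f L \<Longrightarrow> \<exists>n r. \<forall>j\<ge>n. h (restr f j) = r"
  obtains \<sigma> where "set \<sigma> \<subseteq> L" "\<And>\<tau>. set \<tau> \<subseteq> L \<Longrightarrow> h (\<sigma> @ \<tau>) = h \<sigma>"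
proof (rule ccontr)
  assume no_lock: "\<not> thesis"
  have "\<exists>\<tau>. set \<sigma> \<subseteq> L \<longrightarrow> set \<tau> \<subseteq> L \<and> h (\<sigma> @ \<tau>) \<noteq> h \<sigma>" for \<sigma>
    using no_lock that by blast
  then obtain ext where
    ext: "\<And>\<sigma>. set \<sigma> \<subseteq> L \<Longrightarrow> set (ext \<sigma>) \<subseteq> L \<and> h (\<sigma> @ ext \<sigma>) \<noteq> h \<sigma>"
    by metis
  obtain g where "enumeration g L" using enumeration_exists \<open>L \<noteq> {}\<close> .
  then have range_g: "range g = L" by (simp add: enumeration_def)
  define S where "S = rec_nat [] (\<lambda>m \<sigma>. (\<sigma> @ [g m]) @ ext (\<sigma> @ [g m]))"
  have S_Suc: "S (Suc m) = (S m @ [g m]) @ ext (S m @ [g m])" for m by (simp add: S_def)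
  have set_S: "set (S m @ [g m]) \<subseteq> L" for m
  proof (induction m)
    case (Suc m)
    with ext[OF Suc] range_g show ?case by (auto simp: S_Suc)
  qed (use range_g in \<open>auto simp: S_def\<close>)
  obtain f where f: "\<And>m. restr f (length (S m)) = S m" "range f = (\<Union>m. set (S m))"
    "\<And>m. m \<le> length (S m)"
    by (rule prefix_chain_limit[of S]) (auto simp: S_Suc strict_prefix_def)
  have "range f = L"
  proof
    show "range f \<subseteq> L" using set_S by (auto simp: f(2))
    have "g m \<in> set (S (Suc m))" for m by (simp add: S_Suc)
    then show "L \<subseteq> range f" unfolding f(2) range_g[symmetric] by blast
  qed
  then obtain n r where stable: "\<And>j. j \<ge> n \<Longrightarrow> h (restr f j) = r"
    using converges \<open>L \<noteq> {}\<close> unfolding enumeration_def by blast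
  have "restr f (length (S n @ [g n])) = S n @ [g n]"
    using f(1)[of "Suc n"] unfolding S_Suc by (rule restr_eq_appendD)
  then have "h (S n @ [g n]) = r"
    using stable[of "length (S n @ [g n])"] f(3)[of n] by simp
  moreover have "h (S (Suc n)) = r"
    using stable[of "length (S (Suc n))"] f(1)[of "Suc n"] f(3)[of "Suc n"] by simp
  ultimately show False using ext[OF set_S[of n]] by (simp add: S_Suc)
qed

lemma finite_tell_tale:
  assumes "L \<noteq> {}" and h: "identifies h F L"
  obtains D where "finite D" "D \<subseteq> L"
    "\<And>L'. L' \<noteq> {} \<Longrightarrow> D \<subseteq> L' \<Longrightarrow> L' \<subseteq> L \<Longrightarrow> identifies h F L' \<Longrightarrow> L' = L"
proof -
  have "\<exists>n r. \<forall>j\<ge>n. h (restr f j) = r" if "enumeration f L" for f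
    using h that unfolding identifies_def by blast
  then obtain \<sigma> where "set \<sigma> \<subseteq> L" and lock: "\<And>\<tau>. set \<tau> \<subseteq> L \<Longrightarrow> h (\<sigma> @ \<tau>) = h \<sigma>"
    using locking_sequence[OF \<open>L \<noteq> {}\<close>] by blast
  have locked_index: "F (h \<sigma>) = L'"
    if L': "L' \<noteq> {}" "set \<sigma> \<subseteq> L'" "L' \<subseteq> L" and "identifies h F L'" for L'
  proof -
    obtain g where g: "enumeration g L'" using enumeration_exists L'(1) .
    then have "enumeration (\<sigma> \<frown> g) L'" using L'(2) by (auto simp: enumeration_def)
    then obtain n r where "F r = L'" and r: "\<And>j. j \<ge> n \<Longrightarrow> h (restr (\<sigma> \<frown> g) j) = r"
      using \<open>identifies h F L'\<close> unfolding identifies_def by blast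
    have "set (restr g n) \<subseteq> L" using g L'(3) by (auto simp: enumeration_def restr_def)
    then have "h \<sigma> = r" using r[of "length \<sigma> + n"] lock by (simp add: restr_conc)
    with \<open>F r = L'\<close> show ?thesis by simp
  qed
  have index: "F (h \<sigma>) = L"
    using locked_index \<open>L \<noteq> {}\<close> \<open>set \<sigma> \<subseteq> L\<close> order_refl h .
  show thesis
  proof (rule that)
    show "finite (set \<sigma>)" "set \<sigma> \<subseteq> L" by (simp_all add: \<open>set \<sigma> \<subseteq> L\<close>)
    show "L' = L" if "L' \<noteq> {}" "set \<sigma> \<subseteq> L'" "L' \<subseteq> L" "identifies h F L'" for L'
      using locked_index[OF that] index by simp
  qed
qed

lemma PSD_T_identifiable:
  assumes "F \<in> PSD_T"
  obtains h where "\<And>i. identifies h F (F i)"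
proof -
  from assms obtain M T p where M: "oracle_free M" and crit: "psd_crit F M (\<lambda>\<sigma> H. T \<sigma>) p"
    by (auto simp: PSD_T_def)
  have "identifies (\<lambda>\<sigma>. res {} M (T \<sigma>)) F (F i)" for i
    unfolding identifies_def
  proof (intro allI impI)
    fix f
    assume "enumeration f (F i)"
    then obtain n r where "F r = F i" "\<And>j. j \<ge> n \<Longrightarrow> outputs (F i) M (T (restr f j)) r"
      using crit unfolding psd_crit_iff data_plain_teacher by blast
    then show "\<exists>n r. F r = F i \<and> (\<forall>j\<ge>n. res {} M (T (restr f j)) = r)"
      using res_eq outputs_oracle_free[OF M] by metis
  qed
  then show thesis by (rule that)
qed

section \<open>The initial segments of the natural numbers\<close>

definition gold_family :: "nat \<Rightarrow> nat set" where
  "gold_family m = (if m = 0 then UNIV else {..<m})"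

lemma gold_family_eq_iff: "gold_family m = gold_family n \<longleftrightarrow> m = n"
  by (auto simp: gold_family_def infinite_UNIV_nat dest: arg_cong[where f = finite])

lemma mi_gold_family: "mi gold_family (gold_family m) = m"
  unfolding mi_def gold_family_eq_iff by (rule Least_equality) auto

lemma indexed_family_gold: "indexed_family gold_family"
proof (rule indexed_familyI)
  show "decidable 3 (\<lambda>xs. if xs ! 1 = 0 then True else xs ! 2 < xs ! 1)"
    by (intro computable_intros computable_nth) auto
qed (auto simp: gold_family_def)

lemma gold_family_not_PSD_T: "gold_family \<notin> PSD_T"
proof
  assume "gold_family \<in> PSD_T"
  then obtain h where h: "\<And>m. identifies h gold_family (gold_family m)"
    using PSD_T_identifiable by blast
  obtain D where "finite D"
    and D: "\<And>L. L \<noteq> {} \<Longrightarrow> D \<subseteq> L \<Longrightarrow> identifies h gold_family L \<Longrightarrow> L = UNIV"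
    using finite_tell_tale[of UNIV h gold_family] h[of 0] by (auto simp: gold_family_def)
  from \<open>finite D\<close> obtain m where "D \<subseteq> {..<m}" by (auto simp: finite_nat_iff_bounded)
  then have "D \<subseteq> gold_family (Suc m)" by (auto simp: gold_family_def)
  then have "gold_family (Suc m) = UNIV" by (intro D h) (auto simp: gold_family_def)
  then show False using gold_family_eq_iff[of "Suc m" 0] by (simp add: gold_family_def)
qed

text \<open>On data with code \<open>c\<close> the learner searches for the least \<open>x\<close> with \<open>x \<notin> A\<close>; to stop the
  search when \<open>A\<close> is the set of all natural numbers, it first asks whether \<open>c \<in> A\<close>.\<close>

definition gold_test :: recf where
  "gold_test = Comp (PrimRec (Proj 0) Zero) [Comp Oracle [Proj 1], Comp Oracle [Proj 0]]"

definition gold_learner :: recf where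
  "gold_learner = Mu gold_test"

lemma ev_gold_test:
  "ev A gold_test [x, c] (if c \<in> A then 0 else if x \<in> A then 1 else 0) [c, x]"
proof -
  have query: "ev A (Comp Oracle [Proj i]) [x, c] (if [x, c] ! i \<in> A then 1 else 0) [[x, c] ! i]"
    if "i < 2" for i
    using ev_comp[OF evs_cons[OF ev_proj[of i "[x, c]"] evs_nil] ev_oracle] that by simp
  have args: "evs A [Comp Oracle [Proj 1], Comp Oracle [Proj 0]] [x, c]
      [if c \<in> A then 1 else 0, if x \<in> A then 1 else 0] [c, x]"
    using evs_cons[OF query[of 1] evs_cons[OF query[of 0] evs_nil]] by simp
  have zero: "ev A (PrimRec (Proj 0) Zero) (0 # [b]) b []" for b
    using ev_prim0[OF ev_proj[of 0 "[b]"]] by simp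
  have "ev A (PrimRec (Proj 0) Zero) (Suc 0 # [b]) 0 []" for b
    using ev_primS[OF zero ev_zero] by simp
  with zero have "ev A (PrimRec (Proj 0) Zero)
      [if c \<in> A then 1 else 0, if x \<in> A then 1 else 0]
      (if c \<in> A then 0 else if x \<in> A then 1 else 0) []" by auto
  from ev_comp[OF args this] show ?thesis by (simp add: gold_test_def)
qed

lemma evmu_gold_test:
  assumes "m \<le> c" "x \<le> m"
  shows "\<exists>q. evmu {..<m} gold_test [c] x m q \<and> length q = 2 * (m - x) + 2"
  using assms(2)
proof (induction rule: inc_induct)
  case base
  have "evmu {..<m} gold_test [c] m m [c, m]"
    using ev_gold_test[of "{..<m}" m c] assms(1) by (intro evmu_found) simp
  then show ?case by force
next
  case (step x)
  then obtain q where "evmu {..<m} gold_test [c] (Suc x) m q" "length q = 2 * (m - Suc x) + 2"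
    by blast
  moreover have "ev {..<m} gold_test [x, c] (Suc 0) [c, x]"
    using ev_gold_test[of "{..<m}" x c] assms(1) step.hyps by simp
  ultimately have "evmu {..<m} gold_test [c] x m ([c, x] @ q)"
    "length ([c, x] @ q) = 2 * (m - x) + 2"
    using evmu_next step.hyps by (blast, simp)
  then show ?case by blast
qed

lemma ev_gold_learner:
  obtains q where "ev (gold_family m) gold_learner [c] (if c \<in> gold_family m then 0 else m) q"
    "length q \<le> 2 * m + 2"
proof (cases "c \<in> gold_family m")
  case True
  then have "ev (gold_family m) gold_learner [c] 0 [c, 0]"
    using ev_mu[OF evmu_found] ev_gold_test[of "gold_family m" 0 c] by (simp add: gold_learner_def)
  with True that show thesis by simp
next
  case False
  then have A: "gold_family m = {..<m}" "m \<le> c" by (auto simp: gold_family_def split: if_splits)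
  from evmu_gold_test[OF A(2), of 0] obtain q
    where "evmu {..<m} gold_test [c] 0 m q" "length q = 2 * m + 2" by auto
  moreover from this(1) have "ev (gold_family m) gold_learner [c] m q"
    unfolding A(1) gold_learner_def by (rule ev_mu)
  ultimately show thesis using False that by simp
qed

lemma outputs_gold_learner:
  assumes "m \<le> length \<sigma>"
  shows "outputs (gold_family m) gold_learner \<sigma> m"
proof -
  obtain q where
    "ev (gold_family m) gold_learner [list_encode \<sigma>]
       (if list_encode \<sigma> \<in> gold_family m then 0 else m) q"
    by (rule ev_gold_learner)
  moreover have "m \<noteq> 0 \<Longrightarrow> list_encode \<sigma> \<notin> gold_family m"
    using assms length_le_list_encode[of \<sigma>] by (simp add: gold_family_def)
  ultimately show ?thesis by (cases "m = 0") (auto simp: outputs_def)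
qed

lemma length_queries_gold_learner: "length (queries (gold_family m) gold_learner \<sigma>) \<le> 2 * m + 2"
proof -
  obtain q where
    "ev (gold_family m) gold_learner [list_encode \<sigma>]
       (if list_encode \<sigma> \<in> gold_family m then 0 else m) q"
    "length q \<le> 2 * m + 2"
    by (rule ev_gold_learner)
  then show ?thesis by (simp only: queries_eq)
qed

lemma gold_family_PSD_O: "gold_family \<in> PSD_O"
proof -
  have "psd_crit gold_family gold_learner (\<lambda>\<sigma> H. \<sigma>) [:3, 4, 2:]"
    unfolding psd_crit_iff data_plain_teacher mi_gold_family
  proof (intro allI impI exI conjI)
    fix m f
    have poly: "poly [:3, 4, 2:] m = Suc m * (2 * m + 2) + 1" for m :: nat
      by (simp add: algebra_simps)
    have "card (set (restr f m)) \<le> m"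
      using card_length[of "restr f m"] by (simp add: restr_def)
    also have "m < poly [:3, 4, 2:] m" unfolding poly by simp
    finally show "card (set (restr f m)) < poly [:3, 4, 2:] m" .
    have "length (hist (gold_family m) gold_learner (\<lambda>\<sigma> H. \<sigma>) f (Suc m)) \<le> Suc m * (2 * m + 2)"
      by (rule length_hist_le) (rule length_queries_gold_learner)
    then show "length (hist (gold_family m) gold_learner (\<lambda>\<sigma> H. \<sigma>) f (Suc m))
        < poly [:3, 4, 2:] m"
      unfolding poly by linarith
    show "outputs (gold_family m) gold_learner (restr f j) m" if "m \<le> j" for j
      using that by (intro outputs_gold_learner) (simp add: restr_def)
  qed simp
  then show ?thesis unfolding PSD_O_def using indexed_family_gold by blast
qed

section \<open>The hierarchy\<close>

lemma teacher_O_of_teacher: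
  assumes "teacher T"
  shows "teacher_O (\<lambda>\<sigma> H. T \<sigma>)"
proof -
  from assms obtain t where t: "oracle_free t"
    "\<And>\<sigma>. \<exists>q. ev {} t [list_encode \<sigma>] (list_encode (T \<sigma>)) q"
    by (auto simp: teacher_def)
  have "\<exists>q. ev {} (Comp t [Proj 0]) [list_encode \<sigma>, enc_hist H] (list_encode (T \<sigma>)) q" for \<sigma> H
    using t(2) ev_comp[OF evs_cons[OF ev_proj[of 0 "[list_encode \<sigma>, enc_hist H]"] evs_nil]]
    by fastforce
  with t(1) assms show ?thesis
    unfolding teacher_O_def teacher_def by (intro conjI exI[of _ "Comp t [Proj 0]"]) auto
qed

lemma teacher_identity: "teacher (\<lambda>\<sigma>. \<sigma>)"
  by (rule teacherI[of "\<lambda>c. c"]) (auto intro: computable_nth)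

theorem theorem4p6:
  shows "(PSD \<subset> PSD_O \<and> PSD_O \<subset> PSD_TO)
       \<and> (PSD \<subset> PSD_T \<and> PSD_T \<subset> PSD_TO)
       \<and> PSD_O - PSD_T \<noteq> {}
       \<and> PSD_T - PSD_O \<noteq> {}"
proof -
  have "PSD \<subseteq> PSD_O" unfolding PSD_def PSD_O_def by blast
  moreover have "PSD \<subseteq> PSD_T"
    unfolding PSD_def PSD_T_def using teacher_identity by blast
  moreover have "PSD_O \<subseteq> PSD_TO"
    unfolding PSD_O_def PSD_TO_def using teacher_O_of_teacher[OF teacher_identity] by blast
  moreover have "PSD_T \<subseteq> PSD_TO"
    unfolding PSD_T_def PSD_TO_def using teacher_O_of_teacher by blast
  ultimately show ?thesis
    using gold_family_PSD_O gold_family_not_PSD_T diag_family_PSD_T diag_family_not_PSD_O by blast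
qed

end
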